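(* Let $\Xi\subseteq\mathbb{R}^d$ be nonempty, closed and convex, let $c:\Xi\times\Xi\to\mathbb{R}_+$ be such that $c(\xi,\xi')$ is convex in $\xi$ for every fixed $\xi'\in\Xi$, and let $\ell(\xi)=\max_{l\in[L]}\ell_l(\xi)$ for some concave functions $\ell_l:\Xi\to\mathbb{R}$, $l\in[L]$. Let $\widehat\xi_{k,j}\in\Xi$, $p_{k,j}>0$ with $\sum_{j=1}^{N_k}p_{k,j}=1$, and $\varepsilon_k\ge0$ for $j\in[N_k]$, $k\in[K]$, and let $\mathcal A=\times_{k=1}^K[N_k]$. Then the problem $$\begin{array}{cll}\inf & \displaystyle\sum_{k=1}^K\varepsilon_k\lambda_k+\sum_{k=1}^K\sum_{j=1}^{N_k}p_{k,j}\gamma_{k,j}\\ \text{s.t.} & \lambda_k\in\mathbb{R}_+,\ \gamma_k\in\mathbb{R}^{N_k} & \forall k\in[K]\\ & \displaystyle\sup_{\xi\in\Xi}\ \ell(\xi)-\sum_{k=1}^K\lambda_k c(\xi,\widehat\xi_{k,\alpha_k})\le\sum_{k=1}^K\gamma_{k,\alpha_k} & \forall\alpha\in\mathcal A\end{array}$$ is equivalent to the finite convex program $$\begin{array}{cll}\inf & \displaystyle\sum_{k=1}^K\varepsilon_k\lambda_k+\sum_{k=1}^K\sum_{j=1}^{N_k}p_{k,j}\gamma_{k,j}\\ \text{s.t.} & \lambda_k\in\mathbb{R}_+,\ \gamma_k\in\mathbb{R}^{N_k},\ u_{\alpha,l},v_{\alpha,l},w_{\alpha,l,k}\in\mathbb{R}^d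 & \forall\alpha\in\mathcal A,\ k\in[K],\ l\in[L]\\ & \displaystyle[-\ell_l]^*(u_{\alpha,l})+\sigma_\Xi(v_{\alpha,l})+\sum_{k=1}^K\lambda_k c^{*1}\Big(\frac{w_{\alpha,l,k}}{\lambda_k},\widehat\xi_{k,\alpha_k}\Big)\le\sum_{k=1}^K\gamma_{k,\alpha_k} & \forall\alpha\in\mathcal A,\ l\in[L]\\ & \displaystyle u_{\alpha,l}+v_{\alpha,l}+\sum_{k=1}^K w_{\alpha,l,k}=0 & \forall\alpha\in\mathcal A,\ l\in[L].\end{array}$$
   Context: $[n]=\{1,\dots,n\}$. The convex conjugate of $f:\mathbb{R}^d\to[-\infty,\infty]$ is $f^*(u)=\sup_{\xi\in\mathbb{R}^d}\langle u,\xi\rangle-f(\xi)$. The functions $-\ell_l$ and $c(\cdot,\widehat\xi)$ are regarded as convex functions on $\mathbb{R}^d$ by setting them to $+\infty$ outside $\Xi$. $c^{*1}(u,\widehat\xi)$ is the conjugate of $c(\xi,\widehat\xi)$ with respect to its first argument $\xi$. $\sigma_\Xi(v)=\sup_{\xi\in\Xi}\langle v,\xi\rangle$ is the support function of $\Xi$. The perspective of a closed convex function $f$ is $t f(\xi/t)$ for $t\ge0$, where $0f(\xi/0)$ is interpreted as $\sigma_{\mathrm{dom}(f^* )}(\xi)$. Two minimization problems are called equivalent if any feasible solution of the first can be used to construct a feasible solution of the second with the same or a smaller objective value and vice versa; in particular their optimal values coincide. *)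

theory Defs
  imports "HOL-Analysis.Analysis" "HOL-Library.Function_Algebras"
begin

text \<open>Functions into a real vector space carry the pointwise vector space structure, so that
  \<open>convex\<close>, \<open>convex_on\<close> and \<open>linear\<close> apply to tuples of indexed families of decision variables.\<close>

instantiation "fun" :: (type, real_vector) real_vector
begin

definition scaleR_fun :: "real \<Rightarrow> ('a \<Rightarrow> 'b) \<Rightarrow> 'a \<Rightarrow> 'b" where
  "scaleR_fun r f = (\<lambda>x. r *\<^sub>R f x)"

instance
  by standard (auto simp: scaleR_fun_def plus_fun_def fun_eq_iff algebra_simps)

end

subsection \<open>Extended-valued convex analysis\<close>

definition extend_infty :: "'a set \<Rightarrow> ('a \<Rightarrow> real) \<Rightarrow> 'a \<Rightarrow> ereal" where
  "extend_infty X f \<xi> = (if \<xi> \<in> X then ereal (f \<xi>) else \<infinity>)"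

definition conjugate :: "('a::real_inner \<Rightarrow> ereal) \<Rightarrow> 'a \<Rightarrow> ereal" where
  "conjugate f u = (SUP \<xi>. ereal (u \<bullet> \<xi>) - f \<xi>)"

definition support_fun :: "'a::real_inner set \<Rightarrow> 'a \<Rightarrow> ereal" where
  "support_fun X v = (SUP \<xi>\<in>X. ereal (v \<bullet> \<xi>))"

definition eff_dom :: "('a \<Rightarrow> ereal) \<Rightarrow> 'a set" where
  "eff_dom f = {\<xi>. f \<xi> < \<infinity>}"

text \<open>Only used for \<open>t \<ge> 0\<close>. Note that \<open>0 * \<infinity> = 0\<close> in \<^typ>\<open>ereal\<close>, so \<open>t = 0\<close> has to be
  treated separately.\<close>

definition perspective :: "('a::real_inner \<Rightarrow> ereal) \<Rightarrow> real \<Rightarrow> 'a \<Rightarrow> ereal" where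
  "perspective f t \<xi> =
    (if t = 0 then support_fun (eff_dom (conjugate f)) \<xi> else ereal t * f (\<xi> /\<^sub>R t))"

definition ereal_convex_on :: "'a::real_vector set \<Rightarrow> ('a \<Rightarrow> ereal) \<Rightarrow> bool" where
  "ereal_convex_on X g \<longleftrightarrow> convex {(x, r). x \<in> X \<and> g x \<le> ereal r}"

subsection \<open>Minimization problems\<close>

definition equivalent_problems ::
    "'x set \<Rightarrow> ('x \<Rightarrow> real) \<Rightarrow> 'y set \<Rightarrow> ('y \<Rightarrow> real) \<Rightarrow> bool" where
  "equivalent_problems F f G g \<longleftrightarrow>
    (\<forall>x\<in>F. \<exists>y\<in>G. g y \<le> f x) \<and> (\<forall>y\<in>G. \<exists>x\<in>F. f x \<le> g y)"

lemma equivalent_problems_optimal_value: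
  assumes "equivalent_problems F f G g"
  shows "(INF x\<in>F. ereal (f x)) = (INF y\<in>G. ereal (g y))"
  using assms unfolding equivalent_problems_def
  by (intro antisym INF_mono) auto

text \<open>The program of minimizing \<open>f x\<close> over \<open>x \<in> X\<close> subject to \<open>g i x \<le> r i x\<close> and \<open>h i x = 0\<close>
  for all \<open>i \<in> I\<close>.\<close>

definition constrained_set ::
    "'x set \<Rightarrow> 'i set \<Rightarrow> ('i \<Rightarrow> 'x \<Rightarrow> ereal) \<Rightarrow> ('i \<Rightarrow> 'x \<Rightarrow> real) \<Rightarrow> ('i \<Rightarrow> 'x \<Rightarrow> 'e::zero) \<Rightarrow> 'x set"
  where
  "constrained_set X I g r h = {x \<in> X. \<forall>i\<in>I. g i x \<le> ereal (r i x) \<and> h i x = 0}"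

definition finite_convex_program ::
    "'x::real_vector set \<Rightarrow> ('x \<Rightarrow> real) \<Rightarrow> 'i set \<Rightarrow> ('i \<Rightarrow> 'x \<Rightarrow> ereal) \<Rightarrow> ('i \<Rightarrow> 'x \<Rightarrow> real)
      \<Rightarrow> ('i \<Rightarrow> 'x \<Rightarrow> 'e::real_vector) \<Rightarrow> bool" where
  "finite_convex_program X f I g r h \<longleftrightarrow>
    convex X \<and> convex_on X f \<and> finite I \<and>
    (\<forall>i\<in>I. ereal_convex_on X (g i) \<and> concave_on X (r i) \<and> linear (h i))"

subsection \<open>The two problems\<close>

text \<open>Finite families of variables are extensional functions on their finite index sets; in this
  way each program has only finitely many degrees of freedom.\<close>

definition selections :: "nat \<Rightarrow> (nat \<Rightarrow> nat) \<Rightarrow> (nat \<Rightarrow> nat) set" where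
  "selections K N = (\<Pi>\<^sub>E k\<in>{1..K}. {1..N k})"

definition multipliers :: "nat \<Rightarrow> (nat \<Rightarrow> nat) \<Rightarrow> ((nat \<Rightarrow> real) \<times> (nat \<Rightarrow> nat \<Rightarrow> real)) set" where
  "multipliers K N = ({1..K} \<rightarrow>\<^sub>E {0..}) \<times> (\<Pi>\<^sub>E k\<in>{1..K}. {1..N k} \<rightarrow>\<^sub>E UNIV)"

definition cost :: "nat \<Rightarrow> (nat \<Rightarrow> nat) \<Rightarrow> (nat \<Rightarrow> real) \<Rightarrow> (nat \<Rightarrow> nat \<Rightarrow> real)
    \<Rightarrow> (nat \<Rightarrow> real) \<times> (nat \<Rightarrow> nat \<Rightarrow> real) \<Rightarrow> real" where
  "cost K N \<epsilon> p = (\<lambda>(lam, \<gamma>).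
    (\<Sum>k=1..K. \<epsilon> k * lam k) + (\<Sum>k=1..K. \<Sum>j=1..N k. p k j * \<gamma> k j))"

definition semi_infinite_feasible ::
    "(real^'d) set \<Rightarrow> (real^'d \<Rightarrow> real^'d \<Rightarrow> real) \<Rightarrow> (real^'d \<Rightarrow> real) \<Rightarrow> nat \<Rightarrow> (nat \<Rightarrow> nat)
      \<Rightarrow> (nat \<Rightarrow> nat \<Rightarrow> real^'d) \<Rightarrow> ((nat \<Rightarrow> real) \<times> (nat \<Rightarrow> nat \<Rightarrow> real)) set" where
  "semi_infinite_feasible \<Xi> c loss K N \<xi>h = {(lam, \<gamma>) \<in> multipliers K N.
    \<forall>\<alpha>\<in>selections K N.
      (SUP \<xi>\<in>\<Xi>. ereal (loss \<xi> - (\<Sum>k=1..K. lam k * c \<xi> (\<xi>h k (\<alpha> k))))) \<le> ereal (\<Sum>k=1..K. \<gamma> k (\<alpha> k))}"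

text \<open>Decision variables \<open>((lam, \<gamma>), u, v, w)\<close>.\<close>

type_synonym 'd dual_variables =
  "((nat \<Rightarrow> real) \<times> (nat \<Rightarrow> nat \<Rightarrow> real)) \<times> ((nat \<Rightarrow> nat) \<Rightarrow> nat \<Rightarrow> real^'d)
    \<times> ((nat \<Rightarrow> nat) \<Rightarrow> nat \<Rightarrow> real^'d) \<times> ((nat \<Rightarrow> nat) \<Rightarrow> nat \<Rightarrow> nat \<Rightarrow> real^'d)"

definition dual_space :: "nat \<Rightarrow> (nat \<Rightarrow> nat) \<Rightarrow> nat \<Rightarrow> 'd dual_variables set" where
  "dual_space K N L = multipliers K N
    \<times> (selections K N \<rightarrow>\<^sub>E {1..L} \<rightarrow>\<^sub>E UNIV)
    \<times> (selections K N \<rightarrow>\<^sub>E {1..L} \<rightarrow>\<^sub>E UNIV)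
    \<times> (selections K N \<rightarrow>\<^sub>E {1..L} \<rightarrow>\<^sub>E {1..K} \<rightarrow>\<^sub>E UNIV)"

definition dual_cost :: "nat \<Rightarrow> (nat \<Rightarrow> nat) \<Rightarrow> (nat \<Rightarrow> real) \<Rightarrow> (nat \<Rightarrow> nat \<Rightarrow> real)
    \<Rightarrow> 'd dual_variables \<Rightarrow> real" where
  "dual_cost K N \<epsilon> p x = cost K N \<epsilon> p (fst x)"

definition dual_lhs ::
    "(real^'d) set \<Rightarrow> (real^'d \<Rightarrow> real^'d \<Rightarrow> real) \<Rightarrow> (nat \<Rightarrow> real^'d \<Rightarrow> real) \<Rightarrow> nat
      \<Rightarrow> (nat \<Rightarrow> nat \<Rightarrow> real^'d) \<Rightarrow> (nat \<Rightarrow> nat) \<times> nat \<Rightarrow> 'd dual_variables \<Rightarrow> ereal" where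
  "dual_lhs \<Xi> c losses K \<xi>h = (\<lambda>(\<alpha>, l) ((lam, \<gamma>), u, v, w).
    conjugate (extend_infty \<Xi> (\<lambda>\<xi>. - losses l \<xi>)) (u \<alpha> l) + support_fun \<Xi> (v \<alpha> l)
    + (\<Sum>k=1..K. perspective (conjugate (extend_infty \<Xi> (\<lambda>\<xi>. c \<xi> (\<xi>h k (\<alpha> k))))) (lam k) (w \<alpha> l k)))"

definition dual_rhs :: "nat \<Rightarrow> (nat \<Rightarrow> nat) \<times> nat \<Rightarrow> 'd dual_variables \<Rightarrow> real" where
  "dual_rhs K = (\<lambda>(\<alpha>, l) ((lam, \<gamma>), u, v, w). \<Sum>k=1..K. \<gamma> k (\<alpha> k))"

definition dual_eq :: "nat \<Rightarrow> (nat \<Rightarrow> nat) \<times> nat \<Rightarrow> 'd dual_variables \<Rightarrow> real^'d" where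
  "dual_eq K = (\<lambda>(\<alpha>, l) ((lam, \<gamma>), u, v, w). u \<alpha> l + v \<alpha> l + (\<Sum>k=1..K. w \<alpha> l k))"

end

theory Submission
  imports Defs
begin

text \<open>For \<open>t \<ge> 0\<close>, every perspective in the dual program equals
  \<open>SUP \<xi>\<in>\<Xi>. w \<bullet> \<xi> - t * c \<xi> \<xi>'\<close>. At \<open>t = 0\<close> this holds because the
  biconjugate of a nonnegative function on the closed convex set \<open>\<Xi>\<close> has effective domain \<open>\<Xi>\<close>.
  Thus the dual constraints are sums of suprema of affine functions of the decision variables, hence
  convex, and weak duality follows by evaluating all suprema at the same point. For the converse,
  \<open>- losses l\<close> and the \<open>lam k * c\<close> are finite convex functions on the common
  domain \<open>\<Xi>\<close>, so each summand of their sum can be replaced by an affine minorant without lowering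
  the bound on the sum; the slopes of the minorants yield \<open>u\<close> and \<open>w\<close>, with \<open>v = 0\<close>.
  No lower semicontinuity is needed, since the separation is carried out in the affine hull of
  \<open>\<Xi>\<close>.\<close>

section \<open>Separation of convex functions by affine functions\<close>

lemma convex_on_affine:
  assumes "convex X" "linear h"
  shows "convex_on X (\<lambda>x. h x + b)"
  unfolding convex_on_def
proof (intro conjI ballI allI impI)
  fix x y and s t :: real assume "s + t = 1"
  then have "b = s * b + t * b" by (metis distrib_right mult_1)
  then show "h (s *\<^sub>R x + t *\<^sub>R y) + b \<le> s * (h x + b) + t * (h y + b)"
    by (simp add: linear_add[OF assms(2)] linear_scale[OF assms(2)] algebra_simps)
qed (rule assms(1))

text \<open>A hyperplane between the epigraph of \<open>f\<close> and the hypograph of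
  \<open>- g\<close> is the graph of the wanted affine function once it is known not to be vertical.
  Its normal yields the slope \<open>a\<close>; the intercept \<open>b\<close> is then a
  supremum.\<close>

lemma convex_sandwich:
  fixes f g :: "'a::euclidean_space \<Rightarrow> real"
  assumes f: "convex_on S f" and g: "convex_on S g"
    and nonneg: "\<And>x. x \<in> S \<Longrightarrow> 0 \<le> f x + g x"
  obtains a b where "\<And>x. x \<in> S \<Longrightarrow> a \<bullet> x + b \<le> f x" "\<And>x. x \<in> S \<Longrightarrow> - g x \<le> a \<bullet> x + b"
proof (cases "S = {}")
  case True
  then show ?thesis using that by simp
next
  case False
  have S: "convex S" using f by (simp add: convex_on_def)
  \<comment> \<open>Differences \<open>x - y\<close> merge the two sets to be separated into one. As
    \<open>r\<close> lies strictly above \<open>f x + g y\<close>, \<open>0 \<in> C\<close> would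
    give a point with \<open>f x + g x < 0\<close>.\<close>
  define C where "C = {(x - y, r) | x y r. x \<in> S \<and> y \<in> S \<and> f x + g y < r}"
  have CI: "(x - y, r) \<in> C" if "x \<in> S" "y \<in> S" "f x + g y < r" for x y r
    using that unfolding C_def by blast
  have "C \<noteq> {}"
  proof -
    obtain x where "x \<in> S" using False by blast
    then show ?thesis using CI[of x x "f x + g x + 1"] by auto
  qed
  moreover have "0 \<notin> C"
    using nonneg by (fastforce simp: C_def zero_prod_def)
  moreover have "convex C"
  proof (rule convexI)
    fix P Q and s t :: real
    assume PQ: "P \<in> C" "Q \<in> C" and st: "0 \<le> s" "0 \<le> t" "s + t = 1"
    from PQ obtain x y r x' y' r' where
      P: "P = (x - y, r)" "x \<in> S" "y \<in> S" "f x + g y < r" and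
      Q: "Q = (x' - y', r')" "x' \<in> S" "y' \<in> S" "f x' + g y' < r'"
      unfolding C_def by blast
    have "f (s *\<^sub>R x + t *\<^sub>R x') \<le> s * f x + t * f x'" "g (s *\<^sub>R y + t *\<^sub>R y') \<le> s * g y + t * g y'"
      using f g P Q st by (auto simp: convex_on_def)
    \<comment> \<open>One strict summand is enough: the first one if \<open>s > 0\<close>, otherwise
      the second one, because then \<open>t = 1\<close>.\<close>
    moreover have "s * (f x + g y) + t * (f x' + g y') < s * r + t * r'"
    proof (cases "s = 0")
      case True
      then show ?thesis using st Q by simp
    next
      case False
      then show ?thesis using st P Q
        by (intro add_less_le_mono mult_strict_left_mono mult_left_mono) auto
    qed
    moreover have "s *\<^sub>R x + t *\<^sub>R x' \<in> S" "s *\<^sub>R y + t *\<^sub>R y' \<in> S"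
      using S P Q st by (auto simp: convex_def)
    ultimately have "((s *\<^sub>R x + t *\<^sub>R x') - (s *\<^sub>R y + t *\<^sub>R y'), s * r + t * r') \<in> C"
      by (intro CI) (auto simp: algebra_simps)
    moreover have "s *\<^sub>R P + t *\<^sub>R Q = ((s *\<^sub>R x + t *\<^sub>R x') - (s *\<^sub>R y + t *\<^sub>R y'), s * r + t * r')"
      by (simp add: P(1) Q(1) algebra_simps)
    ultimately show "s *\<^sub>R P + t *\<^sub>R Q \<in> C" by simp
  qed
  \<comment> \<open>Besides separating, the normal is placed in \<open>span C\<close>; this is what
    excludes a vertical hyperplane when \<open>S\<close> is not full-dimensional.\<close>
  ultimately obtain n where n: "n \<in> span C" "n \<noteq> 0" "\<forall>z\<in>C. 0 \<le> n \<bullet> z"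
    using separating_hyperplane_set_0_inspan by metis
  obtain u \<beta> where nu: "n = (u, \<beta>)" by (cases n)
  have sep: "0 \<le> u \<bullet> (x - y) + \<beta> * r" if "x \<in> S" "y \<in> S" "f x + g y < r" for x y r
    using n(3) CI[OF that] by (auto simp: nu)
  \<comment> \<open>For \<open>y = x\<close> the term in \<open>u\<close> vanishes while
    \<open>r\<close> can be chosen positive, so \<open>\<beta>\<close> cannot be negative.\<close>
  have "0 \<le> \<beta>"
  proof (rule ccontr)
    assume "\<not> 0 \<le> \<beta>"
    obtain x where x: "x \<in> S" using False by blast
    obtain r where "f x + g x < r" "0 < r" using gt_ex[of "max 0 (f x + g x)"] by auto
    then show False
      using sep[OF x x] \<open>\<not> 0 \<le> \<beta>\<close> by (fastforce simp: zero_le_mult_iff)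
  qed
  moreover have "\<beta> \<noteq> 0"
  \<comment> \<open>A vertical separating hyperplane would be orthogonal to \<open>span C\<close>, which contains its normal.\<close>
  proof
    assume "\<beta> = 0"
    have "0 \<le> u \<bullet> (x - y)" if "x \<in> S" "y \<in> S" for x y
      using sep[OF that, of "f x + g y + 1"] \<open>\<beta> = 0\<close> by simp
    then have "u \<bullet> (x - y) = 0" if "x \<in> S" "y \<in> S" for x y
      using that by (smt (verit) inner_diff_right)
    then have "\<And>z. z \<in> C \<Longrightarrow> orthogonal n z"
      by (auto simp: C_def nu orthogonal_def \<open>\<beta> = 0\<close>)
    then have "orthogonal n n"
      using n(1) orthogonal_to_span by blast
    then show False using n(2) by (simp add: orthogonal_def)
  qed
  ultimately have \<beta>: "0 < \<beta>" by simp
  \<comment> \<open>Dividing \<open>sep\<close> by \<open>\<beta>\<close> gives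
    \<open>a \<bullet> (x - y) \<le> r\<close> for every \<open>r\<close> above
    \<open>f x + g y\<close>; letting \<open>r\<close> decrease to that value gives
    \<open>key\<close>.\<close>
  define a where "a = - u /\<^sub>R \<beta>"
  have key: "a \<bullet> x - a \<bullet> y \<le> f x + g y" if "x \<in> S" "y \<in> S" for x y
  proof (rule field_le_epsilon)
    fix e :: real assume "0 < e"
    from sep[OF that, of "f x + g y + e"] this
    have "- (u \<bullet> (x - y)) \<le> (f x + g y + e) * \<beta>" by (simp add: mult.commute)
    then have "- (u \<bullet> (x - y)) / \<beta> \<le> f x + g y + e"
      using \<beta> by (simp only: pos_divide_le_eq)
    then show "a \<bullet> x - a \<bullet> y \<le> f x + g y + e"
      by (simp add: a_def inner_diff_right divide_inverse algebra_simps)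
  qed
  \<comment> \<open>By \<open>key\<close>, every \<open>- g y - a \<bullet> y\<close> is at most
    every \<open>f x - a \<bullet> x\<close>, so the supremum of the former lies between both
    families.\<close>
  define b where "b = (SUP y\<in>S. - g y - a \<bullet> y)"
  obtain x0 where x0: "x0 \<in> S" using False by blast
  have bdd: "bdd_above ((\<lambda>y. - g y - a \<bullet> y) ` S)"
    using key[OF x0] by (intro bdd_aboveI2[of _ _ "f x0 - a \<bullet> x0"]) (smt (verit))
  show ?thesis
  proof (rule that[of a b])
    fix x assume x: "x \<in> S"
    have "b \<le> f x - a \<bullet> x"
      unfolding b_def using key[OF x] by (intro cSUP_least[OF False]) (smt (verit))
    then show "a \<bullet> x + b \<le> f x" by simp
    show "- g x \<le> a \<bullet> x + b"
      using cSUP_upper[OF x bdd] unfolding b_def by simp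
  qed
qed

text \<open>Minorants are produced one at a time: the induction hypothesis, with \<open>f i\<close>
  absorbed into \<open>f0\<close>, linearizes the functions indexed by \<open>J\<close>, and
  \<open>convex_sandwich\<close> then linearizes \<open>f i\<close>. The function \<open>f0\<close>
  stays, since the dual constraint accounts for it through a conjugate.\<close>

lemma convex_sum_decomposition:
  fixes f :: "'i \<Rightarrow> 'a::euclidean_space \<Rightarrow> real"
  assumes "finite J" "convex_on S f0" "\<And>j. j \<in> J \<Longrightarrow> convex_on S (f j)"
    and "\<And>x. x \<in> S \<Longrightarrow> m \<le> f0 x + (\<Sum>j\<in>J. f j x)"
  shows "\<exists>a b. (\<forall>j\<in>J. \<forall>x\<in>S. a j \<bullet> x + b j \<le> f j x) \<and>
    (\<forall>x\<in>S. m \<le> f0 x + (\<Sum>j\<in>J. a j \<bullet> x + b j))"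
  using assms
proof (induction J arbitrary: f0)
  case empty
  then show ?case by simp
next
  case (insert i J)
  have "convex_on S (\<lambda>x. f0 x + f i x)"
    using insert.prems by (intro convex_on_add) auto
  moreover have "m \<le> (f0 x + f i x) + (\<Sum>j\<in>J. f j x)" if "x \<in> S" for x
    using insert.prems(3)[OF that] insert.hyps by (simp add: algebra_simps)
  ultimately obtain a b where ab: "\<forall>j\<in>J. \<forall>x\<in>S. a j \<bullet> x + b j \<le> f j x"
    and m: "\<forall>x\<in>S. m \<le> f0 x + f i x + (\<Sum>j\<in>J. a j \<bullet> x + b j)"
    using insert.IH[of "\<lambda>x. f0 x + f i x"] insert.prems(2) by auto
  define A where "A = (\<Sum>j\<in>J. a j)"
  define B where "B = (\<Sum>j\<in>J. b j)"
  have sum_eq: "(\<Sum>j\<in>J. a j \<bullet> x + b j) = A \<bullet> x + B" for x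
    by (simp add: A_def B_def sum.distrib inner_sum_left)
  have S: "convex S" using insert.prems(1) by (simp add: convex_on_def)
  \<comment> \<open>The shift by \<open>m\<close> turns the bound from the induction hypothesis into
    the nonnegativity that \<open>convex_sandwich\<close> asks for.\<close>
  have "convex_on S (\<lambda>x. A \<bullet> x + (B - m))"
    using S by (intro convex_on_affine bounded_linear.linear bounded_linear_inner_right)
  then have g: "convex_on S (\<lambda>x. f0 x + (A \<bullet> x + (B - m)))"
    by (rule convex_on_add[OF insert.prems(1)])
  obtain a' b' where ab': "\<And>x. x \<in> S \<Longrightarrow> a' \<bullet> x + b' \<le> f i x"
    "\<And>x. x \<in> S \<Longrightarrow> - (f0 x + (A \<bullet> x + (B - m))) \<le> a' \<bullet> x + b'"
    using convex_sandwich[OF insert.prems(2)[of i] g] m[unfolded sum_eq]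
    by (smt (verit) insertI1)
  have upd: "(\<Sum>j\<in>J. (a(i := a')) j \<bullet> x + (b(i := b')) j) = A \<bullet> x + B" for x
    unfolding sum_eq[symmetric] using insert.hyps by (intro sum.cong) auto
  show ?case
    using ab ab' insert.hyps upd
    by (intro exI[of _ "a(i := a')"] exI[of _ "b(i := b')"]) (fastforce simp: algebra_simps)
qed

section \<open>Conjugates and perspectives of functions extended by infinity\<close>

lemma conjugate_extend_infty:
  "conjugate (extend_infty X f) u = (SUP \<xi>\<in>X. ereal (u \<bullet> \<xi> - f \<xi>))"
  unfolding conjugate_def
proof (rule antisym)
  show "(SUP \<xi>. ereal (u \<bullet> \<xi>) - extend_infty X f \<xi>) \<le> (SUP \<xi>\<in>X. ereal (u \<bullet> \<xi> - f \<xi>))"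
    by (rule SUP_least) (auto simp: extend_infty_def intro: SUP_upper)
  show "(SUP \<xi>\<in>X. ereal (u \<bullet> \<xi> - f \<xi>)) \<le> (SUP \<xi>. ereal (u \<bullet> \<xi>) - extend_infty X f \<xi>)"
    by (rule SUP_mono) (auto simp: extend_infty_def)
qed

text \<open>On \<open>X\<close> the biconjugate lies below \<open>f\<close> by the Fenchel-Young
  inequality. At a point \<open>z\<close> outside \<open>X\<close>, a hyperplane strictly separating
  \<open>z\<close> from \<open>X\<close> gives a ray of slopes whose affine minorants of
  \<open>f\<close> are unbounded at \<open>z\<close>.\<close>

lemma eff_dom_biconjugate:
  fixes X :: "'a::euclidean_space set"
  assumes "closed X" "convex X" and nonneg: "\<And>\<xi>. \<xi> \<in> X \<Longrightarrow> 0 \<le> f \<xi>"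
  shows "eff_dom (conjugate (conjugate (extend_infty X f))) = X"
proof (intro equalityI subsetI)
  fix z assume z: "z \<in> X"
  have "ereal (z \<bullet> u) - conjugate (extend_infty X f) u \<le> ereal (f z)" for u
  proof -
    have "ereal (u \<bullet> z - f z) \<le> conjugate (extend_infty X f) u"
      unfolding conjugate_extend_infty using z by (rule SUP_upper)
    then show ?thesis
      by (cases "conjugate (extend_infty X f) u") (auto simp: inner_commute)
  qed
  then have "conjugate (conjugate (extend_infty X f)) z \<le> ereal (f z)"
    unfolding conjugate_def[of "conjugate _"] by (rule SUP_least)
  then show "z \<in> eff_dom (conjugate (conjugate (extend_infty X f)))"
    by (auto simp: eff_dom_def)
next
  fix z assume "z \<in> eff_dom (conjugate (conjugate (extend_infty X f)))"
  then have fin: "conjugate (conjugate (extend_infty X f)) z < \<infinity>" by (simp add: eff_dom_def)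
  show "z \<in> X"
  proof (rule ccontr)
    assume "z \<notin> X"
    then obtain a b where ab: "a \<bullet> z < b" "\<forall>x\<in>X. b < a \<bullet> x"
      using separating_hyperplane_closed_point assms by metis
    \<comment> \<open>At the slope \<open>- n a\<close>, nonnegativity of \<open>f\<close> bounds
      the conjugate by \<open>- n b\<close>; this slope is then inserted into the supremum defining
      the biconjugate.\<close>
    have ray: "ereal (n * (b - a \<bullet> z)) \<le> conjugate (conjugate (extend_infty X f)) z"
      if "0 \<le> n" for n
    proof -
      have "conjugate (extend_infty X f) ((- n) *\<^sub>R a) \<le> ereal (- n * b)"
        unfolding conjugate_extend_infty
      proof (rule SUP_least)
        fix \<xi> assume "\<xi> \<in> X"
        then have "n * b \<le> n * (a \<bullet> \<xi>)"
          using ab that by (intro mult_left_mono) (auto simp: less_imp_le)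
        then show "ereal ((- n) *\<^sub>R a \<bullet> \<xi> - f \<xi>) \<le> ereal (- n * b)"
          using nonneg[OF \<open>\<xi> \<in> X\<close>] by simp
      qed
      then have "ereal (n * (b - a \<bullet> z)) \<le>
          ereal (z \<bullet> ((- n) *\<^sub>R a)) - conjugate (extend_infty X f) ((- n) *\<^sub>R a)"
        by (cases "conjugate (extend_infty X f) ((- n) *\<^sub>R a)") 
          (auto simp: algebra_simps inner_commute)
      also have "\<dots> \<le> conjugate (conjugate (extend_infty X f)) z"
        unfolding conjugate_def[of "conjugate _"] by (rule SUP_upper) simp
      finally show ?thesis .
    qed
    have "\<not> conjugate (conjugate (extend_infty X f)) z \<le> ereal r" for r
    proof
      assume le: "conjugate (conjugate (extend_infty X f)) z \<le> ereal r"
      define n where "n = (\<bar>r\<bar> + 1) / (b - a \<bullet> z)"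
      have "0 \<le> n" using ab by (simp add: n_def)
      from order_trans[OF ray[OF this] le] show False using ab by (simp add: n_def)
    qed
    then show False using fin ray[of 0]
      by (cases "conjugate (conjugate (extend_infty X f)) z") auto
  qed
qed

text \<open>For \<open>t > 0\<close> the factor \<open>t\<close> moves inside the supremum; for
  \<open>t = 0\<close> the convention in \<open>perspective\<close> gives the support function of
  the domain of the biconjugate, which is \<open>X\<close>. The common formula is a supremum of
  functions linear in \<open>(t, w)\<close>, from which both duality and convexity are read
  off.\<close>

lemma perspective_conjugate:
  fixes X :: "'a::euclidean_space set"
  assumes "X \<noteq> {}" "closed X" "convex X" "\<And>\<xi>. \<xi> \<in> X \<Longrightarrow> 0 \<le> f \<xi>" "0 \<le> t"
  shows "perspective (conjugate (extend_infty X f)) t w = (SUP \<xi>\<in>X. ereal (w \<bullet> \<xi> - t * f \<xi>))"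
proof (cases "t = 0")
  case True
  then show ?thesis
    using assms by (simp add: perspective_def eff_dom_biconjugate support_fun_def)
next
  case False
  with assms have t: "0 < t" by simp
  have "ereal t * (SUP \<xi>\<in>X. ereal ((w /\<^sub>R t) \<bullet> \<xi> - f \<xi>))
      = (SUP \<xi>\<in>X. ereal t * ereal ((w /\<^sub>R t) \<bullet> \<xi> - f \<xi>))"
    using t by (intro Sup_ereal_mult_left' assms(1)) auto
  also have "\<dots> = (SUP \<xi>\<in>X. ereal (w \<bullet> \<xi> - t * f \<xi>))"
    using t by (intro SUP_cong) (auto simp: field_simps)
  finally show ?thesis
    using False by (simp add: perspective_def conjugate_extend_infty)
qed

section \<open>Convexity of extended-valued functions and of sets of families\<close>

lemma ereal_convex_on_cong:
  "(\<And>x. x \<in> X \<Longrightarrow> g x = h x) \<Longrightarrow> ereal_convex_on X g \<longleftrightarrow> ereal_convex_on X h"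
  unfolding ereal_convex_on_def by (intro arg_cong[where f = convex]) auto

lemma ereal_convex_on_SUP:
  assumes "convex X" "\<And>i. i \<in> I \<Longrightarrow> convex_on X (f i)"
  shows "ereal_convex_on X (\<lambda>x. SUP i\<in>I. ereal (f i x))"
  unfolding ereal_convex_on_def
proof (rule convexI)
  fix P Q and s t :: real
  assume P: "P \<in> {(x, r). x \<in> X \<and> (SUP i\<in>I. ereal (f i x)) \<le> ereal r}"
    and Q: "Q \<in> {(x, r). x \<in> X \<and> (SUP i\<in>I. ereal (f i x)) \<le> ereal r}"
    and st: "0 \<le> s" "0 \<le> t" "s + t = 1"
  obtain x r y q where PQ: "P = (x, r)" "Q = (y, q)" by fastforce
  have xy: "x \<in> X" "y \<in> X" "\<And>i. i \<in> I \<Longrightarrow> f i x \<le> r" "\<And>i. i \<in> I \<Longrightarrow> f i y \<le> q"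
    using P Q by (auto simp: PQ SUP_le_iff)
  have "f i (s *\<^sub>R x + t *\<^sub>R y) \<le> s * r + t * q" if "i \<in> I" for i
  proof -
    have "f i (s *\<^sub>R x + t *\<^sub>R y) \<le> s * f i x + t * f i y"
      using assms(2)[OF that] xy st by (auto simp: convex_on_def)
    also have "\<dots> \<le> s * r + t * q"
      using xy that st by (intro add_mono mult_left_mono) auto
    finally show ?thesis .
  qed
  moreover have "s *\<^sub>R x + t *\<^sub>R y \<in> X" using assms(1) xy st by (auto simp: convex_def)
  ultimately show "s *\<^sub>R P + t *\<^sub>R Q \<in> {(x, r). x \<in> X \<and> (SUP i\<in>I. ereal (f i x)) \<le> ereal r}"
    by (auto simp: PQ intro: SUP_least)
qed

text \<open>A real bound on the sum splits into real bounds on \<open>g\<close> and \<open>h\<close>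
  at the same point, so convexity can be used in each epigraph separately.\<close>

lemma ereal_convex_on_add:
  assumes g: "ereal_convex_on X g" and h: "ereal_convex_on X h"
    and bot: "\<And>x. x \<in> X \<Longrightarrow> g x \<noteq> -\<infinity>" "\<And>x. x \<in> X \<Longrightarrow> h x \<noteq> -\<infinity>"
  shows "ereal_convex_on X (\<lambda>x. g x + h x)"
  unfolding ereal_convex_on_def
proof (rule convexI)
  fix P Q and s t :: real
  assume P: "P \<in> {(x, r). x \<in> X \<and> g x + h x \<le> ereal r}"
    and Q: "Q \<in> {(x, r). x \<in> X \<and> g x + h x \<le> ereal r}"
    and st: "0 \<le> s" "0 \<le> t" "s + t = 1"
  obtain x r y q where PQ: "P = (x, r)" "Q = (y, q)" by fastforce
  \<comment> \<open>Since \<open>-\<infinity>\<close> is excluded, a real bound on the sum forces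
    \<open>g z\<close> to be real, and \<open>a = g z\<close>, \<open>b = e - a\<close>
    work.\<close>
  have split: "\<exists>a b. g z \<le> ereal a \<and> h z \<le> ereal b \<and> a + b = e" if z: "z \<in> X" "g z + h z \<le> ereal e" for z e
  proof -
    obtain a where "g z = ereal a"
      using z bot[OF z(1)] by (cases "g z") auto
    moreover from this z have "h z \<le> ereal (e - a)"
      by (cases "h z") auto
    ultimately show ?thesis by (metis add_diff_cancel_left' diff_add_cancel order_refl add.commute)
  qed
  obtain a b where ab: "g x \<le> ereal a" "h x \<le> ereal b" "a + b = r"
    using split P unfolding PQ by blast
  obtain a' b' where ab': "g y \<le> ereal a'" "h y \<le> ereal b'" "a' + b' = q"
    using split Q unfolding PQ by blast
  have xy: "x \<in> X" "y \<in> X" using P Q by (auto simp: PQ)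
  have "s *\<^sub>R (x, a) + t *\<^sub>R (y, a') \<in> {(x, r). x \<in> X \<and> g x \<le> ereal r}"
    by (rule convexD[OF g[unfolded ereal_convex_on_def]]) (use xy ab ab' st in auto)
  moreover have "s *\<^sub>R (x, b) + t *\<^sub>R (y, b') \<in> {(x, r). x \<in> X \<and> h x \<le> ereal r}"
    by (rule convexD[OF h[unfolded ereal_convex_on_def]]) (use xy ab ab' st in auto)
  ultimately have z: "s *\<^sub>R x + t *\<^sub>R y \<in> X" "g (s *\<^sub>R x + t *\<^sub>R y) \<le> ereal (s * a + t * a')"
    "h (s *\<^sub>R x + t *\<^sub>R y) \<le> ereal (s * b + t * b')"
    by auto
  have "ereal (s * a + t * a') + ereal (s * b + t * b') = ereal (s * r + t * q)"
    using ab(3) ab'(3) by (auto simp: algebra_simps)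
  with z(1) add_mono[OF z(2,3)]
  show "s *\<^sub>R P + t *\<^sub>R Q \<in> {(x, r). x \<in> X \<and> g x + h x \<le> ereal r}"
    by (auto simp: PQ)
qed

lemma sum_neq_MInfty:
  fixes f :: "'a \<Rightarrow> ereal"
  shows "(\<And>j. j \<in> J \<Longrightarrow> f j \<noteq> -\<infinity>) \<Longrightarrow> (\<Sum>j\<in>J. f j) \<noteq> -\<infinity>"
  by (induction J rule: infinite_finite_induct) auto

lemma ereal_convex_on_sum:
  assumes "finite J" "convex X" "\<And>j. j \<in> J \<Longrightarrow> ereal_convex_on X (g j)"
    and "\<And>j x. j \<in> J \<Longrightarrow> x \<in> X \<Longrightarrow> g j x \<noteq> -\<infinity>"
  shows "ereal_convex_on X (\<lambda>x. \<Sum>j\<in>J. g j x)"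
  using assms
proof (induction J)
  case empty
  \<comment> \<open>The zero function is treated as a supremum over a one-point index set.\<close>
  then show ?case using ereal_convex_on_SUP[of X "{()}" "\<lambda>_ _. 0"]
    by (simp add: convex_on_def zero_ereal_def)
next
  case (insert i J)
  have "(\<Sum>j\<in>J. g j x) \<noteq> -\<infinity>" if "x \<in> X" for x
    using insert.prems(3) that by (intro sum_neq_MInfty) auto
  then show ?case
    using insert by (simp add: ereal_convex_on_add)
qed

text \<open>Extensional functions equal \<open>undefined\<close> outside \<open>I\<close>, and this
  value is preserved because the weights of a convex combination add up to one.\<close>

lemma convex_PiE:
  assumes "\<And>i. i \<in> I \<Longrightarrow> convex (F i)"
  shows "convex (Pi\<^sub>E I F)"
proof (rule convexI)
  fix f g and s t :: real
  assume "f \<in> Pi\<^sub>E I F" "g \<in> Pi\<^sub>E I F" and st: "0 \<le> s" "0 \<le> t" "s + t = 1"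
  then have "s *\<^sub>R undefined + t *\<^sub>R undefined = (undefined :: 'b)"
    by (metis scaleR_add_left scaleR_one)
  then show "s *\<^sub>R f + t *\<^sub>R g \<in> Pi\<^sub>E I F"
    using assms st \<open>f \<in> _\<close> \<open>g \<in> _\<close>
    by (auto simp: scaleR_fun_def PiE_iff extensional_def convex_def)
qed

lemma convex_multipliers: "convex (multipliers K N)"
  unfolding multipliers_def by (intro convex_Times convex_PiE convex_real_interval convex_UNIV)

lemma convex_dual_space: "convex (dual_space K N L :: 'd::finite dual_variables set)"
  unfolding dual_space_def by (intro convex_Times convex_PiE convex_multipliers convex_UNIV)

lemma finite_selections: "finite (selections K N)"
  unfolding selections_def by (intro finite_PiE) auto


section \<open>Duality for a single constraint\<close>

text \<open>This is the case of one fixed pair \<open>(\<alpha>, l)\<close>, with \<open>f\<close>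
  in the role of \<open>losses l\<close>. In the forward direction \<open>v = 0\<close> suffices
  because the restriction to \<open>X\<close> is already built into the extended functions.\<close>

lemma constraint_duality:
  fixes X :: "'a::euclidean_space set"
  assumes "finite J" and X: "X \<noteq> {}" "closed X" "convex X" and f: "concave_on X f"
    and c: "\<And>k. k \<in> J \<Longrightarrow> convex_on X (c k)" "\<And>k \<xi>. k \<in> J \<Longrightarrow> \<xi> \<in> X \<Longrightarrow> 0 \<le> c k \<xi>"
    and lam: "\<And>k. k \<in> J \<Longrightarrow> 0 \<le> lam k"
  shows "(\<forall>\<xi>\<in>X. f \<xi> - (\<Sum>k\<in>J. lam k * c k \<xi>) \<le> s) \<longleftrightarrow>
    (\<exists>u v w. conjugate (extend_infty X (\<lambda>\<xi>. - f \<xi>)) u + support_fun X v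
        + (\<Sum>k\<in>J. perspective (conjugate (extend_infty X (c k))) (lam k) (w k)) \<le> ereal s
      \<and> u + v + (\<Sum>k\<in>J. w k) = 0)" (is "?L \<longleftrightarrow> ?R")
proof -
  have persp: "(\<Sum>k\<in>J. perspective (conjugate (extend_infty X (c k))) (lam k) (w k))
      = (\<Sum>k\<in>J. SUP \<xi>\<in>X. ereal (w k \<bullet> \<xi> - lam k * c k \<xi>))" for w
    using assms by (intro sum.cong refl perspective_conjugate) auto
  show ?thesis
    unfolding persp conjugate_extend_infty support_fun_def
  proof
    assume ?L
    have "convex_on X (\<lambda>\<xi>. - f \<xi>)"
      using f by (simp add: concave_on_def)
    moreover have "convex_on X (\<lambda>\<xi>. lam k * c k \<xi>)" if "k \<in> J" for k
      using c(1) lam that by (intro convex_on_cmul) auto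
    moreover have "- s \<le> - f \<xi> + (\<Sum>k\<in>J. lam k * c k \<xi>)" if "\<xi> \<in> X" for \<xi>
      using \<open>?L\<close> that by force
    ultimately obtain w b where wb: "\<And>k \<xi>. k \<in> J \<Longrightarrow> \<xi> \<in> X \<Longrightarrow> w k \<bullet> \<xi> + b k \<le> lam k * c k \<xi>"
      "\<And>\<xi>. \<xi> \<in> X \<Longrightarrow> - s \<le> - f \<xi> + (\<Sum>k\<in>J. w k \<bullet> \<xi> + b k)"
      using convex_sum_decomposition[OF \<open>finite J\<close>, of X "\<lambda>\<xi>. - f \<xi>" "\<lambda>k \<xi>. lam k * c k \<xi>" "- s"]
      by blast
    \<comment> \<open>With \<open>v = 0\<close> the balance equation forces this \<open>u\<close>.
      The conjugate at \<open>u\<close> is at most \<open>s\<close> plus the sum of the intercepts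
      \<open>b k\<close>, the perspective terms are at most \<open>- b k\<close>, and the intercepts
      cancel.\<close>
    define u where "u = - (\<Sum>k\<in>J. w k)"
    have "(SUP \<xi>\<in>X. ereal (u \<bullet> \<xi> - - f \<xi>)) \<le> ereal (s + (\<Sum>k\<in>J. b k))"
      using wb(2) by (intro SUP_least) (force simp: u_def inner_sum_left sum.distrib)
    moreover have "(SUP \<xi>\<in>X. ereal (0 \<bullet> \<xi>)) \<le> 0"
      by (intro SUP_least) simp
    moreover have "(\<Sum>k\<in>J. SUP \<xi>\<in>X. ereal (w k \<bullet> \<xi> - lam k * c k \<xi>)) \<le> (\<Sum>k\<in>J. ereal (- b k))"
      using wb(1) by (intro sum_mono SUP_least) (force simp: algebra_simps)
    ultimately have "(SUP \<xi>\<in>X. ereal (u \<bullet> \<xi> - - f \<xi>)) + (SUP \<xi>\<in>X. ereal (0 \<bullet> \<xi>))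
        + (\<Sum>k\<in>J. SUP \<xi>\<in>X. ereal (w k \<bullet> \<xi> - lam k * c k \<xi>))
        \<le> ereal (s + (\<Sum>k\<in>J. b k)) + 0 + (\<Sum>k\<in>J. ereal (- b k))"
      by (intro add_mono)
    also have "\<dots> = ereal s"
      by (simp add: sum_ereal sum_negf)
    finally show "\<exists>u v w. (SUP \<xi>\<in>X. ereal (u \<bullet> \<xi> - - f \<xi>)) + (SUP \<xi>\<in>X. ereal (v \<bullet> \<xi>))
        + (\<Sum>k\<in>J. SUP \<xi>\<in>X. ereal (w k \<bullet> \<xi> - lam k * c k \<xi>)) \<le> ereal s \<and> u + v + (\<Sum>k\<in>J. w k) = 0"
      by (intro exI[of _ u] exI[of _ 0] exI[of _ w]) (simp add: u_def)
  next
    assume "\<exists>u v w. (SUP \<xi>\<in>X. ereal (u \<bullet> \<xi> - - f \<xi>)) + (SUP \<xi>\<in>X. ereal (v \<bullet> \<xi>))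
        + (\<Sum>k\<in>J. SUP \<xi>\<in>X. ereal (w k \<bullet> \<xi> - lam k * c k \<xi>)) \<le> ereal s \<and> u + v + (\<Sum>k\<in>J. w k) = 0"
    then obtain u v w where le: "(SUP \<xi>\<in>X. ereal (u \<bullet> \<xi> - - f \<xi>)) + (SUP \<xi>\<in>X. ereal (v \<bullet> \<xi>))
        + (\<Sum>k\<in>J. SUP \<xi>\<in>X. ereal (w k \<bullet> \<xi> - lam k * c k \<xi>)) \<le> ereal s"
      and 0: "u + v + (\<Sum>k\<in>J. w k) = 0" by blast
    show ?L
    proof
      fix \<xi> assume \<xi>: "\<xi> \<in> X"
      \<comment> \<open>All suprema are bounded below at the same \<open>\<xi>\<close>, so that the
        linear terms cancel by the balance equation.\<close>
      have "ereal (u \<bullet> \<xi> - - f \<xi>) + ereal (v \<bullet> \<xi>) + (\<Sum>k\<in>J. ereal (w k \<bullet> \<xi> - lam k * c k \<xi>)) \<le> ereal s"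
        by (rule order_trans[OF _ le]) (intro add_mono sum_mono SUP_upper \<xi>)
      then have "(u \<bullet> \<xi> + v \<bullet> \<xi> + (\<Sum>k\<in>J. w k \<bullet> \<xi>)) + f \<xi> - (\<Sum>k\<in>J. lam k * c k \<xi>) \<le> s"
        by (simp add: sum_ereal sum_subtractf algebra_simps)
      moreover have "u \<bullet> \<xi> + v \<bullet> \<xi> + (\<Sum>k\<in>J. w k \<bullet> \<xi>) = (u + v + (\<Sum>k\<in>J. w k)) \<bullet> \<xi>"
        by (simp add: inner_add_left inner_sum_left)
      ultimately show "f \<xi> - (\<Sum>k\<in>J. lam k * c k \<xi>) \<le> s"
        by (simp add: 0)
    qed
  qed
qed

section \<open>Convexity of the dual constraint functions\<close>

lemma SUP_ereal_neq_MInfty: "X \<noteq> {} \<Longrightarrow> (SUP x\<in>X. ereal (f x)) \<noteq> - \<infinity>"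
  by (metis MInfty_neq_ereal(1) SUP_upper ereal_infty_less_eq(2) ex_in_conv)

lemma ereal_convex_on_dual_lhs:
  fixes \<Xi> :: "(real^'d) set"
  assumes \<Xi>: "\<Xi> \<noteq> {}" "closed \<Xi>" "convex \<Xi>"
    and c: "\<forall>\<xi>\<in>\<Xi>. \<forall>\<xi>'\<in>\<Xi>. 0 \<le> c \<xi> \<xi>'"
    and \<xi>h: "\<forall>k\<in>{1..K}. \<forall>j\<in>{1..N k}. \<xi>h k j \<in> \<Xi>"
    and \<alpha>: "\<alpha> \<in> selections K N"
  shows "ereal_convex_on (dual_space K N L) (dual_lhs \<Xi> c losses K \<xi>h (\<alpha>, l))"
proof -
  let ?D = "dual_space K N L :: 'd dual_variables set"
  \<comment> \<open>The coordinates entering the constraint \<open>(\<alpha>, l)\<close> are linear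
    projections on the whole type of decision variables.\<close>
  define U :: "'d dual_variables \<Rightarrow> real^'d" where "U = (\<lambda>((lam, \<gamma>), u, v, w). u \<alpha> l)"
  define V :: "'d dual_variables \<Rightarrow> real^'d" where "V = (\<lambda>((lam, \<gamma>), u, v, w). v \<alpha> l)"
  define W :: "nat \<Rightarrow> 'd dual_variables \<Rightarrow> real^'d" where "W k = (\<lambda>((lam, \<gamma>), u, v, w). w \<alpha> l k)" for k
  define \<Lambda> :: "nat \<Rightarrow> 'd dual_variables \<Rightarrow> real" where "\<Lambda> k = (\<lambda>((lam, \<gamma>), u, v, w). lam k)" for k
  have lin: "linear U" "linear V" "linear (W k)" "linear (\<Lambda> k)" for k
    by (auto intro!: linearI simp: U_def V_def W_def \<Lambda>_def scaleR_fun_def)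
  \<comment> \<open>Membership in \<open>dual_space\<close> makes the multipliers nonnegative, so
    \<open>perspective_conjugate\<close> applies. The added zeros give every term the shape
    \<open>h x + b\<close> of \<open>convex_on_affine\<close>.\<close>
  have "dual_lhs \<Xi> c losses K \<xi>h (\<alpha>, l) x = (SUP \<xi>\<in>\<Xi>. ereal (U x \<bullet> \<xi> + losses l \<xi>))
      + (SUP \<xi>\<in>\<Xi>. ereal (V x \<bullet> \<xi> + 0))
      + (\<Sum>k=1..K. SUP \<xi>\<in>\<Xi>. ereal (W k x \<bullet> \<xi> - \<Lambda> k x * c \<xi> (\<xi>h k (\<alpha> k)) + 0))"
    if x: "x \<in> ?D" for x
  proof -
    obtain lam \<gamma> u v w where x_eq: "x = ((lam, \<gamma>), u, v, w)" by (metis prod.exhaust)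
    have lam: "0 \<le> lam k" if "k \<in> {1..K}" for k
      using x that by (auto simp: x_eq dual_space_def multipliers_def)
    have ref: "\<xi>h k (\<alpha> k) \<in> \<Xi>" if "k \<in> {1..K}" for k
      using \<alpha> \<xi>h that by (auto simp: selections_def PiE_iff)
    have "perspective (conjugate (extend_infty \<Xi> (\<lambda>\<xi>. c \<xi> (\<xi>h k (\<alpha> k))))) (lam k) (w \<alpha> l k)
        = (SUP \<xi>\<in>\<Xi>. ereal (w \<alpha> l k \<bullet> \<xi> - lam k * c \<xi> (\<xi>h k (\<alpha> k))))" if "k \<in> {1..K}" for k
      using c ref[OF that] lam[OF that] by (intro perspective_conjugate \<Xi>) auto
    then show ?thesis
      by (simp add: x_eq dual_lhs_def conjugate_extend_infty support_fun_def U_def V_def W_def \<Lambda>_def)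
  qed
  then have cong: "ereal_convex_on ?D (dual_lhs \<Xi> c losses K \<xi>h (\<alpha>, l)) \<longleftrightarrow>
    ereal_convex_on ?D (\<lambda>x. (SUP \<xi>\<in>\<Xi>. ereal (U x \<bullet> \<xi> + losses l \<xi>))
      + (SUP \<xi>\<in>\<Xi>. ereal (V x \<bullet> \<xi> + 0))
      + (\<Sum>k=1..K. SUP \<xi>\<in>\<Xi>. ereal (W k x \<bullet> \<xi> - \<Lambda> k x * c \<xi> (\<xi>h k (\<alpha> k)) + 0)))"
    by (rule ereal_convex_on_cong)
  have lin': "linear (\<lambda>x. U x \<bullet> \<xi>)" "linear (\<lambda>x. V x \<bullet> \<xi>)" "linear (\<lambda>x. W k x \<bullet> \<xi> - \<Lambda> k x * r)"
    for \<xi> k r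
    by (intro linearI; simp add: lin[THEN linear_add] lin[THEN linear_scale] algebra_simps)+
  have U: "ereal_convex_on ?D (\<lambda>x. SUP \<xi>\<in>\<Xi>. ereal (U x \<bullet> \<xi> + losses l \<xi>))"
    and V: "ereal_convex_on ?D (\<lambda>x. SUP \<xi>\<in>\<Xi>. ereal (V x \<bullet> \<xi> + 0))"
    and W: "ereal_convex_on ?D (\<lambda>x. SUP \<xi>\<in>\<Xi>. ereal (W k x \<bullet> \<xi> - \<Lambda> k x * c \<xi> (\<xi>h k (\<alpha> k)) + 0))" for k
    using convex_on_affine[OF convex_dual_space lin'(1)] convex_on_affine[OF convex_dual_space lin'(2)]
      convex_on_affine[OF convex_dual_space lin'(3)]
    by (simp_all only: ereal_convex_on_SUP convex_dual_space)
  have "ereal_convex_on ?D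
    (\<lambda>x. \<Sum>k=1..K. SUP \<xi>\<in>\<Xi>. ereal (W k x \<bullet> \<xi> - \<Lambda> k x * c \<xi> (\<xi>h k (\<alpha> k)) + 0))"
    by (rule ereal_convex_on_sum[OF finite_atLeastAtMost convex_dual_space W SUP_ereal_neq_MInfty[OF \<Xi>(1)]])
  then show ?thesis
    unfolding cong
    by (intro ereal_convex_on_add U V)
      (simp_all only: ereal_plus_eq_MInfty sum_neq_MInfty SUP_ereal_neq_MInfty[OF \<Xi>(1)]
        not_False_eq_True simp_thms)
qed

section \<open>Convexity of the finite program and its equivalence to the semi-infinite one\<close>

theorem theorem3:
  fixes \<Xi> :: "(real^'d) set"
    and c :: "real^'d \<Rightarrow> real^'d \<Rightarrow> real"
    and loss :: "real^'d \<Rightarrow> real"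
    and losses :: "nat \<Rightarrow> real^'d \<Rightarrow> real"
    and K L :: nat
    and N :: "nat \<Rightarrow> nat"
    and \<xi>h :: "nat \<Rightarrow> nat \<Rightarrow> real^'d"
    and p :: "nat \<Rightarrow> nat \<Rightarrow> real"
    and \<epsilon> :: "nat \<Rightarrow> real"
  assumes "\<Xi> \<noteq> {}" "closed \<Xi>" "convex \<Xi>"
    and "\<forall>\<xi>\<in>\<Xi>. \<forall>\<xi>'\<in>\<Xi>. 0 \<le> c \<xi> \<xi>'"
    and "\<forall>\<xi>'\<in>\<Xi>. convex_on \<Xi> (\<lambda>\<xi>. c \<xi> \<xi>')"
    and "1 \<le> L"
    and "\<forall>l\<in>{1..L}. concave_on \<Xi> (losses l)"
    and "\<forall>\<xi>\<in>\<Xi>. loss \<xi> = Max ((\<lambda>l. losses l \<xi>) ` {1..L})"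
    and "\<forall>k\<in>{1..K}. \<forall>j\<in>{1..N k}. \<xi>h k j \<in> \<Xi>"
    and "\<forall>k\<in>{1..K}. \<forall>j\<in>{1..N k}. 0 < p k j"
    and "\<forall>k\<in>{1..K}. (\<Sum>j=1..N k. p k j) = 1"
    and "\<forall>k\<in>{1..K}. 0 \<le> \<epsilon> k"
  shows "finite_convex_program (dual_space K N L) (dual_cost K N \<epsilon> p)
           (selections K N \<times> {1..L}) (dual_lhs \<Xi> c losses K \<xi>h) (dual_rhs K) (dual_eq K)
         \<and> equivalent_problems
           (semi_infinite_feasible \<Xi> c loss K N \<xi>h) (cost K N \<epsilon> p)
           (constrained_set (dual_space K N L) (selections K N \<times> {1..L})
              (dual_lhs \<Xi> c losses K \<xi>h) (dual_rhs K) (dual_eq K))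
           (dual_cost K N \<epsilon> p)"
proof
  let ?D = "dual_space K N L :: 'd dual_variables set"
  have D: "convex ?D" by (rule convex_dual_space)
  have "linear (dual_cost K N \<epsilon> p :: 'd dual_variables \<Rightarrow> real)"
    by (auto intro!: linearI simp: dual_cost_def cost_def scaleR_fun_def distrib_left sum.distrib
        sum_distrib_left mult.left_commute)
  then have "convex_on ?D (dual_cost K N \<epsilon> p)"
    using convex_on_affine[OF D, where b = 0] by simp
  moreover have "concave_on ?D (dual_rhs K i)" for i
  proof -
    have "linear (\<lambda>x :: 'd dual_variables. - dual_rhs K i x)"
      by (cases i) (auto intro!: linearI simp: dual_rhs_def scaleR_fun_def sum.distrib sum_distrib_left)
    then show ?thesis
      unfolding concave_on_def using convex_on_affine[OF D, where b = 0] by fastforce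
  qed
  moreover have "linear (dual_eq K i :: 'd dual_variables \<Rightarrow> real^'d)" for i
    by (cases i) (auto intro!: linearI simp: dual_eq_def scaleR_fun_def sum.distrib scaleR_add_right scaleR_sum_right)
  ultimately show "finite_convex_program ?D (dual_cost K N \<epsilon> p)
      (selections K N \<times> {1..L}) (dual_lhs \<Xi> c losses K \<xi>h) (dual_rhs K) (dual_eq K)"
    using D ereal_convex_on_dual_lhs[OF assms(1-4,9)]
    by (auto simp: finite_convex_program_def finite_selections)
next
  \<comment> \<open>The maximum over \<open>l\<close> splits into one constraint per
    \<open>l\<close>; \<open>1 \<le> L\<close> makes it a maximum over a nonempty set.\<close>
  have loss_iff: "(SUP \<xi>\<in>\<Xi>. ereal (loss \<xi> - (\<Sum>k=1..K. lam k * c \<xi> (\<xi>h k (\<alpha> k))))) \<le> ereal s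
    \<longleftrightarrow> (\<forall>l\<in>{1..L}. \<forall>\<xi>\<in>\<Xi>. losses l \<xi> - (\<Sum>k=1..K. lam k * c \<xi> (\<xi>h k (\<alpha> k))) \<le> s)" for lam \<alpha> s
  proof -
    have "loss \<xi> - t \<le> s \<longleftrightarrow> (\<forall>l\<in>{1..L}. losses l \<xi> - t \<le> s)" if "\<xi> \<in> \<Xi>" for \<xi> t
    proof -
      have "loss \<xi> \<le> s + t \<longleftrightarrow> (\<forall>l\<in>{1..L}. losses l \<xi> \<le> s + t)"
        using that assms(6,8) by (simp add: Max_le_iff)
      then show ?thesis by (simp add: algebra_simps)
    qed
    then show ?thesis by (auto simp: SUP_le_iff)
  qed
  have duality: "(\<forall>\<xi>\<in>\<Xi>. losses l \<xi> - (\<Sum>k=1..K. lam k * c \<xi> (\<xi>h k (\<alpha> k))) \<le> s) \<longleftrightarrow>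
    (\<exists>u v w. conjugate (extend_infty \<Xi> (\<lambda>\<xi>. - losses l \<xi>)) u + support_fun \<Xi> v
        + (\<Sum>k=1..K. perspective (conjugate (extend_infty \<Xi> (\<lambda>\<xi>. c \<xi> (\<xi>h k (\<alpha> k))))) (lam k) (w k))
          \<le> ereal s
      \<and> u + v + (\<Sum>k=1..K. w k) = 0)"
    if "\<alpha> \<in> selections K N" "l \<in> {1..L}" "(lam, \<gamma>) \<in> multipliers K N" for \<alpha> l lam \<gamma> s
  proof -
    have "\<xi>h k (\<alpha> k) \<in> \<Xi>" if "k \<in> {1..K}" for k
      using \<open>\<alpha> \<in> _\<close> assms(9) that by (auto simp: selections_def PiE_iff)
    moreover have "0 \<le> lam k" if "k \<in> {1..K}" for k
      using \<open>(lam, \<gamma>) \<in> _\<close> that by (auto simp: multipliers_def)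
    ultimately show ?thesis
      using assms that by (intro constraint_duality) auto
  qed
  show "equivalent_problems
      (semi_infinite_feasible \<Xi> c loss K N \<xi>h) (cost K N \<epsilon> p)
      (constrained_set (dual_space K N L) (selections K N \<times> {1..L})
        (dual_lhs \<Xi> c losses K \<xi>h) (dual_rhs K) (dual_eq K))
      (dual_cost K N \<epsilon> p)"
    \<comment> \<open>Both directions keep \<open>(lam, \<gamma>)\<close> and only attach or drop
      \<open>u\<close>, \<open>v\<close>, \<open>w\<close>, so the objective values agree.\<close>
    unfolding equivalent_problems_def
  proof (intro conjI ballI)
    fix x assume x_feas: "x \<in> semi_infinite_feasible \<Xi> c loss K N \<xi>h"
    obtain lam \<gamma> where x: "x = (lam, \<gamma>)" by (cases x)
    have mult: "(lam, \<gamma>) \<in> multipliers K N"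
      and feas: "\<forall>\<alpha>\<in>selections K N. \<forall>l\<in>{1..L}. \<forall>\<xi>\<in>\<Xi>.
        losses l \<xi> - (\<Sum>k=1..K. lam k * c \<xi> (\<xi>h k (\<alpha> k))) \<le> (\<Sum>k=1..K. \<gamma> k (\<alpha> k))"
      using x_feas unfolding x semi_infinite_feasible_def loss_iff mem_Collect_eq prod.case by blast+
    \<comment> \<open>Naming the constraint as a predicate keeps the simultaneous choice of
      \<open>u\<close>, \<open>v\<close>, \<open>w\<close> for all pairs
      \<open>(\<alpha>, l)\<close> a plain first-order step.\<close>
    define Q where "Q \<alpha> l u v w \<longleftrightarrow> conjugate (extend_infty \<Xi> (\<lambda>\<xi>. - losses l \<xi>)) u + support_fun \<Xi> v
        + (\<Sum>k=1..K. perspective (conjugate (extend_infty \<Xi> (\<lambda>\<xi>. c \<xi> (\<xi>h k (\<alpha> k))))) (lam k) (w k))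
          \<le> ereal (\<Sum>k=1..K. \<gamma> k (\<alpha> k))
      \<and> u + v + (\<Sum>k=1..K. w k) = 0" for \<alpha> l u v w
    have "\<exists>u v w. Q \<alpha> l u v w" if "\<alpha> \<in> selections K N" "l \<in> {1..L}" for \<alpha> l
      using feas that unfolding Q_def duality[OF that mult, symmetric] by blast
    then obtain u v w where uvw: "\<And>\<alpha> l. \<alpha> \<in> selections K N \<Longrightarrow> l \<in> {1..L} \<Longrightarrow> Q \<alpha> l (u \<alpha> l) (v \<alpha> l) (w \<alpha> l)"
      by metis
    \<comment> \<open>The chosen families are restricted to their index sets, since
      \<open>dual_space\<close> consists of extensional functions.\<close>
    define y where "y = ((lam, \<gamma>),
      (\<lambda>\<alpha>\<in>selections K N. \<lambda>l\<in>{1..L}. u \<alpha> l),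
      (\<lambda>\<alpha>\<in>selections K N. \<lambda>l\<in>{1..L}. v \<alpha> l),
      (\<lambda>\<alpha>\<in>selections K N. \<lambda>l\<in>{1..L}. \<lambda>k\<in>{1..K}. w \<alpha> l k))"
    have "y \<in> constrained_set (dual_space K N L) (selections K N \<times> {1..L})
        (dual_lhs \<Xi> c losses K \<xi>h) (dual_rhs K) (dual_eq K)"
      using uvw[unfolded Q_def] mult
      by (auto simp: constrained_set_def y_def dual_space_def dual_lhs_def dual_rhs_def dual_eq_def)
    then show "\<exists>y\<in>constrained_set (dual_space K N L) (selections K N \<times> {1..L})
        (dual_lhs \<Xi> c losses K \<xi>h) (dual_rhs K) (dual_eq K). dual_cost K N \<epsilon> p y \<le> cost K N \<epsilon> p x"
      by (rule bexI[rotated]) (simp add: dual_cost_def y_def x)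
  next
    fix y assume y: "y \<in> constrained_set (dual_space K N L) (selections K N \<times> {1..L})
        (dual_lhs \<Xi> c losses K \<xi>h) (dual_rhs K) (dual_eq K)"
    obtain lam \<gamma> u v w where y_eq: "y = ((lam, \<gamma>), u, v, w)" by (metis prod.exhaust)
    have mult: "(lam, \<gamma>) \<in> multipliers K N"
      using y by (simp add: constrained_set_def dual_space_def y_eq)
    have "\<forall>\<xi>\<in>\<Xi>. losses l \<xi> - (\<Sum>k=1..K. lam k * c \<xi> (\<xi>h k (\<alpha> k))) \<le> (\<Sum>k=1..K. \<gamma> k (\<alpha> k))"
      if "\<alpha> \<in> selections K N" "l \<in> {1..L}" for \<alpha> l
      unfolding duality[OF that mult]
      by (rule exI[of _ "u \<alpha> l"], rule exI[of _ "v \<alpha> l"], rule exI[of _ "w \<alpha> l"])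
        (use y that in \<open>auto simp: constrained_set_def y_eq dual_lhs_def dual_rhs_def dual_eq_def\<close>)
    then have "(lam, \<gamma>) \<in> semi_infinite_feasible \<Xi> c loss K N \<xi>h"
      using mult unfolding semi_infinite_feasible_def loss_iff by blast
    then show "\<exists>x\<in>semi_infinite_feasible \<Xi> c loss K N \<xi>h. cost K N \<epsilon> p x \<le> dual_cost K N \<epsilon> p y"
      by (rule bexI[rotated]) (simp add: dual_cost_def y_eq)
  qed
qed

end
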